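(* Let $(X,\unlhd,\wedge,\vee,0,1)$ be a bounded modular trellis and define binary operations $Z,Z^*$ on $X$ by $$Z(x,y)=\begin{cases} x\wedge y & \text{if } x\vee y=1,\\ 0 & \text{otherwise,}\end{cases}\qquad Z^*(x,y)=\begin{cases} x\vee y & \text{if } x\wedge y=0,\\ 1 & \text{otherwise.}\end{cases}$$ Then $Z$ is a pseudo-t-norm on $X$ and $Z^*$ is a pseudo-t-conorm on $X$.
   Context: A pseudo-order $\unlhd$ on a set $X$ is a reflexive and antisymmetric relation (not necessarily transitive); lower/upper bounds, infima and suprema are defined as for partially ordered sets (they are unique when they exist). A trellis $(X,\unlhd,\wedge,\vee)$ is a set with a pseudo-order in which any two elements $x,y$ have an infimum $x\wedge y$ and a supremum $x\vee y$. It is bounded, written $(X,\unlhd,\wedge,\vee,0,1)$, if it has elements $0,1$ with $0\unlhd x\unlhd 1$ for all $x\in X$. It is modular if $x\unlhd z$ implies $x\vee(y\wedge z)=(x\vee y)\wedge z$ for every $y\in X$. An element $\alpha\in X$ is right-transitive if $\alpha\unlhd x\unlhd y$ implies $\alpha\unlhd y$; left-transitive if $x\unlhd y\unlhd\alpha$ implies $x\unlhd\alpha$; middle-transitive if $x\unlhd\alpha\unlhd y$ implies $x\unlhd y$ (for all $x,y\in X$); transitive if all three hold. A triple $(x,y,z)$ is $\wedge$-associative if $(x\wedge y)\wedge z=x\wedge(y\wedge z)$, and $\vee$-associative if $(x\vee y)\vee z=x\vee(y\vee z)$. An element is $\wedge$-associative (resp. $\vee$-associative) if every triple in $X^3$ containing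 it is $\wedge$-associative (resp. $\vee$-associative). A binary operation $F$ on $X$ is weakly-increasing if, whenever $x\unlhd y$ and at least one of $x,y$ is transitive, $F(x,z)\unlhd F(y,z)$ for all $z\in X$. It is weakly-associative if $F(x,F(y,z))=F(F(x,y),z)$ for all $x,y,z\in X$ such that at least one of $x,y,z$ is $\wedge$-associative or at least one of $x,y,z$ is $\vee$-associative. A pseudo-t-norm on $X$ is a commutative, weakly-increasing, weakly-associative binary operation $T$ with $T(1,x)=x$ for all $x\in X$; a pseudo-t-conorm is a commutative, weakly-increasing, weakly-associative binary operation $S$ with $S(0,x)=x$ for all $x\in X$. *)

theory Defs
  imports Main
begin

definition is_infimum :: "'a set \<Rightarrow> ('a \<Rightarrow> 'a \<Rightarrow> bool) \<Rightarrow> 'a \<Rightarrow> 'a \<Rightarrow> 'a \<Rightarrow> bool" where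
  "is_infimum X le x y m \<longleftrightarrow>
     m \<in> X \<and> le m x \<and> le m y \<and> (\<forall>l\<in>X. le l x \<and> le l y \<longrightarrow> le l m)"

definition is_supremum :: "'a set \<Rightarrow> ('a \<Rightarrow> 'a \<Rightarrow> bool) \<Rightarrow> 'a \<Rightarrow> 'a \<Rightarrow> 'a \<Rightarrow> bool" where
  "is_supremum X le x y s \<longleftrightarrow>
     s \<in> X \<and> le x s \<and> le y s \<and> (\<forall>u\<in>X. le x u \<and> le y u \<longrightarrow> le s u)"

locale pseudo_order =
  fixes X :: "'a set"
    and le :: "'a \<Rightarrow> 'a \<Rightarrow> bool" (infix \<open>\<unlhd>\<close> 50)
  assumes pseudo_refl: "reflp_on X (\<unlhd>)"
    and pseudo_antisym: "antisymp_on X (\<unlhd>)"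
begin

definition right_transitive :: "'a \<Rightarrow> bool" where
  "right_transitive a \<longleftrightarrow> (\<forall>x\<in>X. \<forall>y\<in>X. a \<unlhd> x \<and> x \<unlhd> y \<longrightarrow> a \<unlhd> y)"

definition left_transitive :: "'a \<Rightarrow> bool" where
  "left_transitive a \<longleftrightarrow> (\<forall>x\<in>X. \<forall>y\<in>X. x \<unlhd> y \<and> y \<unlhd> a \<longrightarrow> x \<unlhd> a)"

definition middle_transitive :: "'a \<Rightarrow> bool" where
  "middle_transitive a \<longleftrightarrow> (\<forall>x\<in>X. \<forall>y\<in>X. x \<unlhd> a \<and> a \<unlhd> y \<longrightarrow> x \<unlhd> y)"

definition transitive_elem :: "'a \<Rightarrow> bool" where
  "transitive_elem a \<longleftrightarrow> right_transitive a \<and> left_transitive a \<and> middle_transitive a"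

definition weakly_increasing :: "('a \<Rightarrow> 'a \<Rightarrow> 'a) \<Rightarrow> bool" where
  "weakly_increasing F \<longleftrightarrow>
     (\<forall>x\<in>X. \<forall>y\<in>X. x \<unlhd> y \<and> (transitive_elem x \<or> transitive_elem y)
        \<longrightarrow> (\<forall>z\<in>X. F x z \<unlhd> F y z))"

end

text \<open>The operations \<open>meet\<close> and \<open>join\<close> are determined by \<open>\<unlhd>\<close> on \<open>X\<close>;
  their values outside \<open>X\<close> are unconstrained and irrelevant.\<close>

locale trellis = pseudo_order X le
  for X :: "'a set"
    and le :: "'a \<Rightarrow> 'a \<Rightarrow> bool" (infix \<open>\<unlhd>\<close> 50) +
  fixes meet :: "'a \<Rightarrow> 'a \<Rightarrow> 'a" (infixl \<open>\<sqinter>\<close> 70)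
    and join :: "'a \<Rightarrow> 'a \<Rightarrow> 'a" (infixl \<open>\<squnion>\<close> 65)
  assumes meet_infimum: "\<lbrakk>x \<in> X; y \<in> X\<rbrakk> \<Longrightarrow> is_infimum X (\<unlhd>) x y (x \<sqinter> y)"
    and join_supremum: "\<lbrakk>x \<in> X; y \<in> X\<rbrakk> \<Longrightarrow> is_supremum X (\<unlhd>) x y (x \<squnion> y)"
begin

definition meet_assoc_triple :: "'a \<Rightarrow> 'a \<Rightarrow> 'a \<Rightarrow> bool" where
  "meet_assoc_triple x y z \<longleftrightarrow> (x \<sqinter> y) \<sqinter> z = x \<sqinter> (y \<sqinter> z)"

definition join_assoc_triple :: "'a \<Rightarrow> 'a \<Rightarrow> 'a \<Rightarrow> bool" where
  "join_assoc_triple x y z \<longleftrightarrow> (x \<squnion> y) \<squnion> z = x \<squnion> (y \<squnion> z)"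

definition meet_assoc_elem :: "'a \<Rightarrow> bool" where
  "meet_assoc_elem a \<longleftrightarrow>
     (\<forall>x\<in>X. \<forall>y\<in>X. \<forall>z\<in>X. a \<in> {x, y, z} \<longrightarrow> meet_assoc_triple x y z)"

definition join_assoc_elem :: "'a \<Rightarrow> bool" where
  "join_assoc_elem a \<longleftrightarrow>
     (\<forall>x\<in>X. \<forall>y\<in>X. \<forall>z\<in>X. a \<in> {x, y, z} \<longrightarrow> join_assoc_triple x y z)"

definition weakly_associative :: "('a \<Rightarrow> 'a \<Rightarrow> 'a) \<Rightarrow> bool" where
  "weakly_associative F \<longleftrightarrow>
     (\<forall>x\<in>X. \<forall>y\<in>X. \<forall>z\<in>X.
        (\<exists>a\<in>{x, y, z}. meet_assoc_elem a) \<or> (\<exists>a\<in>{x, y, z}. join_assoc_elem a)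
        \<longrightarrow> F x (F y z) = F (F x y) z)"

end

locale bounded_trellis = trellis X le meet join
  for X :: "'a set"
    and le :: "'a \<Rightarrow> 'a \<Rightarrow> bool" (infix \<open>\<unlhd>\<close> 50)
    and meet :: "'a \<Rightarrow> 'a \<Rightarrow> 'a" (infixl \<open>\<sqinter>\<close> 70)
    and join :: "'a \<Rightarrow> 'a \<Rightarrow> 'a" (infixl \<open>\<squnion>\<close> 65) +
  fixes zero :: 'a (\<open>\<zero>\<close>)
    and one :: 'a (\<open>\<one>\<close>)
  assumes zero_closed: "\<zero> \<in> X"
    and one_closed: "\<one> \<in> X"
    and zero_least: "x \<in> X \<Longrightarrow> \<zero> \<unlhd> x"
    and one_greatest: "x \<in> X \<Longrightarrow> x \<unlhd> \<one>"
begin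

text \<open>The first conjunct of the next two definitions says that the operation is
  a binary operation on \<open>X\<close>.\<close>

definition pseudo_t_norm :: "('a \<Rightarrow> 'a \<Rightarrow> 'a) \<Rightarrow> bool" where
  "pseudo_t_norm T \<longleftrightarrow>
     (\<forall>x\<in>X. \<forall>y\<in>X. T x y \<in> X) \<and>
     (\<forall>x\<in>X. \<forall>y\<in>X. T x y = T y x) \<and>
     weakly_increasing T \<and>
     weakly_associative T \<and>
     (\<forall>x\<in>X. T \<one> x = x)"

definition pseudo_t_conorm :: "('a \<Rightarrow> 'a \<Rightarrow> 'a) \<Rightarrow> bool" where
  "pseudo_t_conorm S \<longleftrightarrow>
     (\<forall>x\<in>X. \<forall>y\<in>X. S x y \<in> X) \<and>
     (\<forall>x\<in>X. \<forall>y\<in>X. S x y = S y x) \<and>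
     weakly_increasing S \<and>
     weakly_associative S \<and>
     (\<forall>x\<in>X. S \<zero> x = x)"

definition Z_norm :: "'a \<Rightarrow> 'a \<Rightarrow> 'a" where
  "Z_norm x y = (if x \<squnion> y = \<one> then x \<sqinter> y else \<zero>)"

definition Z_conorm :: "'a \<Rightarrow> 'a \<Rightarrow> 'a" where
  "Z_conorm x y = (if x \<sqinter> y = \<zero> then x \<squnion> y else \<one>)"

end

locale bounded_modular_trellis = bounded_trellis X le meet join zero one
  for X :: "'a set"
    and le :: "'a \<Rightarrow> 'a \<Rightarrow> bool" (infix \<open>\<unlhd>\<close> 50)
    and meet :: "'a \<Rightarrow> 'a \<Rightarrow> 'a" (infixl \<open>\<sqinter>\<close> 70)
    and join :: "'a \<Rightarrow> 'a \<Rightarrow> 'a" (infixl \<open>\<squnion>\<close> 65)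
    and zero :: 'a (\<open>\<zero>\<close>)
    and one :: 'a (\<open>\<one>\<close>) +
  assumes modular:
    "\<lbrakk>x \<in> X; y \<in> X; z \<in> X; x \<unlhd> z\<rbrakk> \<Longrightarrow> x \<squnion> (y \<sqinter> z) = (x \<squnion> y) \<sqinter> z"

end

theory Submission
  imports Defs
begin

text \<open>Meets and joins in a trellis need not be monotone or associative, so the usual lattice argument
  is replaced by the modular law.

  Boundary, commutativity and monotonicity of \<open>Z\<close> are direct: a transitive element among \<open>x \<unlhd> y\<close>
  supplies the missing instances of transitivity. The substance is weak associativity. Both bracketings
  of \<open>Z\<close> applied to \<open>x\<close>, \<open>y\<close>, \<open>z\<close> take the value \<open>\<zero>\<close> except when
  \<open>y \<squnion> z = \<one>\<close> and \<open>x \<squnion> (y \<sqinter> z) = \<one>\<close> (where the left one is \<open>x \<sqinter> (y \<sqinter> z)\<close>), respectively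
  when \<open>x \<squnion> y = \<one>\<close> and \<open>(x \<sqinter> y) \<squnion> z = \<one>\<close> (where the right one is \<open>(x \<sqinter> y) \<sqinter> z\<close>).
  So it has to be shown that the two conditions agree and that they force the two meets to agree.
  The modular law does nearly all of this for arbitrary elements: the first condition gives
  \<open>(x \<sqinter> y) \<squnion> z = \<one>\<close> (\<open>join_meet_eq_one_rotate\<close>), it makes \<open>x \<squnion> y = \<one>\<close> and \<open>x \<squnion> z = \<one>\<close>
  equivalent (\<open>join_eq_one_exchange\<close>), and if these hold, the two meets coincide
  (\<open>meet_assoc_if_joins_one\<close>). What is left is one instance of monotonicity, namely
  \<open>x \<squnion> y = \<one>\<close> or \<open>x \<squnion> z = \<one>\<close>, and for it a single middle-transitive element among the three
  suffices (\<open>join_eq_one_if_middle_transitive\<close>). Finally, an element that is associative for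
  either operation is middle-transitive.

  The claim for \<open>Z\<^sup>*\<close> is the claim for \<open>Z\<close> in the dual trellis.\<close>

context bounded_modular_trellis
begin

section \<open>Order, meets and joins\<close>

lemma le_refl: "x \<in> X \<Longrightarrow> x \<unlhd> x"
  using pseudo_refl by (simp add: reflp_on_def)

lemma le_antisym: "\<lbrakk>x \<in> X; y \<in> X; x \<unlhd> y; y \<unlhd> x\<rbrakk> \<Longrightarrow> x = y"
  using pseudo_antisym by (auto dest: antisymp_onD)

lemma meet_closed [simp]: "\<lbrakk>x \<in> X; y \<in> X\<rbrakk> \<Longrightarrow> x \<sqinter> y \<in> X"
  and meet_le1 [simp]: "\<lbrakk>x \<in> X; y \<in> X\<rbrakk> \<Longrightarrow> x \<sqinter> y \<unlhd> x"
  and meet_le2 [simp]: "\<lbrakk>x \<in> X; y \<in> X\<rbrakk> \<Longrightarrow> x \<sqinter> y \<unlhd> y"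
  and le_meetI: "\<lbrakk>l \<in> X; x \<in> X; y \<in> X; l \<unlhd> x; l \<unlhd> y\<rbrakk> \<Longrightarrow> l \<unlhd> x \<sqinter> y"
  using meet_infimum unfolding is_infimum_def by blast+

lemma join_closed [simp]: "\<lbrakk>x \<in> X; y \<in> X\<rbrakk> \<Longrightarrow> x \<squnion> y \<in> X"
  and le_join1 [simp]: "\<lbrakk>x \<in> X; y \<in> X\<rbrakk> \<Longrightarrow> x \<unlhd> x \<squnion> y"
  and le_join2 [simp]: "\<lbrakk>x \<in> X; y \<in> X\<rbrakk> \<Longrightarrow> y \<unlhd> x \<squnion> y"
  and join_leI: "\<lbrakk>u \<in> X; x \<in> X; y \<in> X; x \<unlhd> u; y \<unlhd> u\<rbrakk> \<Longrightarrow> x \<squnion> y \<unlhd> u"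
  using join_supremum unfolding is_supremum_def by blast+

declare zero_closed [simp] one_closed [simp]

lemma meet_commute: "\<lbrakk>x \<in> X; y \<in> X\<rbrakk> \<Longrightarrow> x \<sqinter> y = y \<sqinter> x"
  by (intro le_antisym le_meetI) simp_all

lemma join_commute: "\<lbrakk>x \<in> X; y \<in> X\<rbrakk> \<Longrightarrow> x \<squnion> y = y \<squnion> x"
  by (intro le_antisym join_leI) simp_all

lemma le_iff_meet: "\<lbrakk>x \<in> X; y \<in> X\<rbrakk> \<Longrightarrow> x \<unlhd> y \<longleftrightarrow> x \<sqinter> y = x"
  by (metis le_antisym le_meetI le_refl meet_closed meet_le1 meet_le2)

lemma le_iff_join: "\<lbrakk>x \<in> X; y \<in> X\<rbrakk> \<Longrightarrow> x \<unlhd> y \<longleftrightarrow> x \<squnion> y = y"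
  by (metis le_antisym join_leI le_refl join_closed le_join1 le_join2)

lemma one_meet [simp]: "x \<in> X \<Longrightarrow> \<one> \<sqinter> x = x"
  by (metis le_iff_meet meet_commute one_closed one_greatest)

lemma one_join [simp]: "x \<in> X \<Longrightarrow> \<one> \<squnion> x = \<one>"
  by (metis le_iff_join join_commute one_closed one_greatest)

lemma zero_join [simp]: "x \<in> X \<Longrightarrow> \<zero> \<squnion> x = x"
  by (simp add: zero_least flip: le_iff_join)

lemma zero_meet [simp]: "x \<in> X \<Longrightarrow> \<zero> \<sqinter> x = \<zero>"
  by (simp add: zero_least flip: le_iff_meet)

lemma eq_one_if_one_le: "\<lbrakk>x \<in> X; \<one> \<unlhd> x\<rbrakk> \<Longrightarrow> x = \<one>"
  by (simp add: le_antisym one_greatest)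

lemma middle_transitiveD:
  "\<lbrakk>middle_transitive a; x \<in> X; y \<in> X; x \<unlhd> a; a \<unlhd> y\<rbrakk> \<Longrightarrow> x \<unlhd> y"
  by (auto simp: middle_transitive_def)

lemma middle_transitive_if_meet_assoc:
  assumes "a \<in> X" "meet_assoc_elem a"
  shows "middle_transitive a"
  unfolding middle_transitive_def
proof (intro ballI impI, elim conjE)
  fix x y assume xy: "x \<in> X" "y \<in> X" "x \<unlhd> a" "a \<unlhd> y"
  have "(x \<sqinter> a) \<sqinter> y = x \<sqinter> (a \<sqinter> y)"
    using assms xy by (auto simp: meet_assoc_elem_def meet_assoc_triple_def)
  then show "x \<unlhd> y"
    using assms(1) xy by (simp add: le_iff_meet)
qed

lemma middle_transitive_if_join_assoc:
  assumes "a \<in> X" "join_assoc_elem a"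
  shows "middle_transitive a"
  unfolding middle_transitive_def
proof (intro ballI impI, elim conjE)
  fix x y assume xy: "x \<in> X" "y \<in> X" "x \<unlhd> a" "a \<unlhd> y"
  have "(x \<squnion> a) \<squnion> y = x \<squnion> (a \<squnion> y)"
    using assms xy by (auto simp: join_assoc_elem_def join_assoc_triple_def)
  then show "x \<unlhd> y"
    using assms(1) xy by (simp add: le_iff_join)
qed

section \<open>Consequences of the modular law for joins equal to \<open>\<one>\<close>\<close>

text \<open>Modularity at \<open>v \<unlhd> z\<close>: when \<open>v \<squnion> x\<close> is the top element, \<open>x \<sqinter> z\<close> supplies exactly
  what \<open>v\<close> lacks of \<open>z\<close>.\<close>

lemma join_meet_eq_upper:
  assumes "x \<in> X" "v \<in> X" "z \<in> X" "v \<unlhd> z" "v \<squnion> x = \<one>"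
  shows "v \<squnion> (x \<sqinter> z) = z"
  using assms modular by simp

lemma join_meet_eq_one_rotate:
  assumes X: "x \<in> X" "y \<in> X" "z \<in> X"
    and yz: "y \<squnion> z = \<one>" and x_yz: "x \<squnion> (y \<sqinter> z) = \<one>"
  shows "(x \<sqinter> y) \<squnion> z = \<one>"
proof -
  define U where "U = (x \<sqinter> y) \<squnion> z"
  have U: "U \<in> X"
    using X by (simp add: U_def)
  have "(x \<sqinter> y) \<squnion> (z \<sqinter> y) = y"
    using join_meet_eq_upper[of x "y \<sqinter> z" y] X x_yz by (simp add: join_commute meet_commute)
  \<comment> \<open>The same join is \<open>U \<sqinter> y\<close> by modularity at \<open>x \<sqinter> y \<unlhd> y\<close>; this puts \<open>y\<close> below \<open>U\<close>,
    although \<open>y \<sqinter> z \<unlhd> z \<unlhd> U\<close> alone would not put \<open>y \<sqinter> z\<close> below \<open>U\<close>.\<close>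
  then have "U \<sqinter> y = y"
    using modular[of "x \<sqinter> y" z y] X by (simp add: U_def)
  then have "y \<unlhd> U"
    using X U by (metis le_iff_meet meet_commute)
  moreover have "z \<unlhd> U"
    using X by (simp add: U_def)
  ultimately have "y \<squnion> z \<unlhd> U"
    using X U by (simp add: join_leI)
  then show ?thesis
    using U yz eq_one_if_one_le by (simp add: U_def)
qed

text \<open>The element \<open>z\<close> is the join of \<open>y \<sqinter> z\<close> and \<open>x \<sqinter> z\<close>. Cutting \<open>z\<close> down to
  \<open>z \<sqinter> (x \<squnion> y)\<close> loses neither part, so \<open>z\<close> lies below \<open>x \<squnion> y\<close>.\<close>

lemma join_eq_one_exchange:
  assumes X: "x \<in> X" "y \<in> X" "z \<in> X"
    and yz: "y \<squnion> z = \<one>" and x_yz: "x \<squnion> (y \<sqinter> z) = \<one>" and xz: "x \<squnion> z = \<one>"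
  shows "x \<squnion> y = \<one>"
proof -
  define W where "W = x \<squnion> y"
  define e where "e = z \<sqinter> W"
  have W: "W \<in> X" "x \<unlhd> W" "y \<unlhd> W"
    using X by (simp_all add: W_def)
  have e: "e \<in> X" "e \<unlhd> z" "e \<unlhd> W"
    using X W by (simp_all add: e_def)
  have "e \<squnion> y = W" "e \<squnion> x = W"
    using join_meet_eq_upper[of z y W] join_meet_eq_upper[of z x W] X W yz xz
    by (simp_all add: e_def join_commute)
  then have "e \<squnion> (y \<sqinter> z) = e" "e \<squnion> (x \<sqinter> z) = e"
    using modular[of e y z] modular[of e x z] X W e by (simp_all add: e_def meet_commute)
  then have "y \<sqinter> z \<unlhd> e" "x \<sqinter> z \<unlhd> e"
    using X e by (metis le_join2 meet_closed)+
  then have "(y \<sqinter> z) \<squnion> (x \<sqinter> z) \<unlhd> e"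
    using X e by (simp add: join_leI)
  moreover have "(y \<sqinter> z) \<squnion> (x \<sqinter> z) = z"
    using join_meet_eq_upper[of x "y \<sqinter> z" z] X x_yz by (simp add: join_commute)
  ultimately have "e = z"
    using X e le_antisym by simp
  then have "y \<squnion> z \<unlhd> W"
    using X W e by (simp add: join_leI)
  then show ?thesis
    using W yz eq_one_if_one_le by (simp add: W_def)
qed

text \<open>By \<open>join_eq_one_exchange\<close> it is enough that one of \<open>x \<squnion> y\<close> and \<open>x \<squnion> z\<close> is \<open>\<one>\<close>.
  A middle-transitive \<open>y\<close> or \<open>z\<close> carries \<open>y \<sqinter> z\<close> below the corresponding join,
  a middle-transitive \<open>x\<close> carries \<open>x \<sqinter> y\<close> below \<open>x \<squnion> z\<close>.\<close>

lemma join_eq_one_if_middle_transitive: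
  assumes X: "x \<in> X" "y \<in> X" "z \<in> X"
    and yz: "y \<squnion> z = \<one>" and x_yz: "x \<squnion> (y \<sqinter> z) = \<one>"
    and mid: "\<exists>a\<in>{x, y, z}. middle_transitive a"
  shows "x \<squnion> y = \<one> \<and> x \<squnion> z = \<one>"
proof -
  have "x \<squnion> y = \<one> \<or> x \<squnion> z = \<one>"
  proof -
    consider "middle_transitive x" | "middle_transitive y" | "middle_transitive z"
      using mid by blast
    then show ?thesis
    proof cases
      case 1
      then have "x \<sqinter> y \<unlhd> x \<squnion> z"
        using X by (auto intro: middle_transitiveD)
      then have "(x \<sqinter> y) \<squnion> z \<unlhd> x \<squnion> z"
        using X by (simp add: join_leI)
      then show ?thesis
        using X join_meet_eq_one_rotate[OF X yz x_yz] by (simp add: eq_one_if_one_le)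
    next
      case 2
      then have "y \<sqinter> z \<unlhd> x \<squnion> y"
        using X by (auto intro: middle_transitiveD)
      then have "x \<squnion> (y \<sqinter> z) \<unlhd> x \<squnion> y"
        using X by (simp add: join_leI)
      then show ?thesis
        using X x_yz by (simp add: eq_one_if_one_le)
    next
      case 3
      then have "y \<sqinter> z \<unlhd> x \<squnion> z"
        using X by (auto intro: middle_transitiveD)
      then have "x \<squnion> (y \<sqinter> z) \<unlhd> x \<squnion> z"
        using X by (simp add: join_leI)
      then show ?thesis
        using X x_yz by (simp add: eq_one_if_one_le)
    qed
  qed
  moreover have "z \<squnion> y = \<one>" "x \<squnion> (z \<sqinter> y) = \<one>"
    using X yz x_yz by (simp_all add: join_commute meet_commute)
  ultimately show ?thesis
    using join_eq_one_exchange X yz x_yz by blast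
qed

text \<open>A substitute for transitivity along \<open>x \<sqinter> v \<unlhd> v \<unlhd> z\<close>: adjoining \<open>k = x \<sqinter> v\<close> to \<open>z\<close>
  does not change the meet with \<open>x\<close>, and an element above \<open>z\<close> is determined by its meet with
  \<open>x\<close> because \<open>x \<squnion> z = \<one>\<close>.\<close>

lemma meet_le_if_joins_one:
  assumes X: "x \<in> X" "v \<in> X" "z \<in> X"
    and vz: "v \<unlhd> z" and xv: "x \<squnion> v = \<one>" and xz: "x \<squnion> z = \<one>"
  shows "x \<sqinter> v \<unlhd> z"
proof -
  define k where "k = x \<sqinter> v"
  have k: "k \<in> X" "k \<unlhd> x"
    using X by (simp_all add: k_def)
  have "(x \<sqinter> z) \<squnion> (v \<sqinter> x) = ((x \<sqinter> z) \<squnion> v) \<sqinter> x"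
    using X by (intro modular) simp_all
  also have "\<dots> = x \<sqinter> z"
    using join_meet_eq_upper[of x v z] X vz xv by (simp add: join_commute meet_commute)
  finally have "k \<squnion> (x \<sqinter> z) = x \<sqinter> z"
    using X by (simp add: k_def meet_commute join_commute)
  then have "(k \<squnion> z) \<sqinter> x = x \<sqinter> z"
    using modular[of k z x] X k by (simp add: meet_commute)
  then have "k \<squnion> z = z \<squnion> (x \<sqinter> z)"
    using join_meet_eq_upper[of x z "k \<squnion> z"] X k xz
    by (simp add: meet_commute join_commute)
  also have "\<dots> = z"
    using X by (metis join_commute le_iff_join meet_closed meet_le2)
  finally show ?thesis
    using X k by (simp add: le_iff_join k_def)
qed

lemma meet_assoc_if_joins_one:
  assumes X: "x \<in> X" "y \<in> X" "z \<in> X"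
    and joins: "x \<squnion> y = \<one>" "y \<squnion> z = \<one>" "x \<squnion> z = \<one>"
    and x_yz: "x \<squnion> (y \<sqinter> z) = \<one>"
  shows "x \<sqinter> (y \<sqinter> z) = (x \<sqinter> y) \<sqinter> z"
proof (rule le_antisym)
  show "x \<sqinter> (y \<sqinter> z) \<unlhd> (x \<sqinter> y) \<sqinter> z"
    using X joins x_yz by (simp add: le_meetI meet_le_if_joins_one)
  have z_xy: "z \<squnion> (x \<sqinter> y) = \<one>" "z \<squnion> x = \<one>" "z \<squnion> y = \<one>"
    using join_meet_eq_one_rotate[of x y z] X joins x_yz by (simp_all add: join_commute)
  then have "z \<sqinter> (x \<sqinter> y) \<unlhd> x \<sqinter> (y \<sqinter> z)"
    using X by (simp add: le_meetI meet_le_if_joins_one)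
  then show "(x \<sqinter> y) \<sqinter> z \<unlhd> x \<sqinter> (y \<sqinter> z)"
    using X by (simp add: meet_commute)
qed (use X in simp_all)

section \<open>The operation \<open>Z\<close>\<close>

lemma Z_norm_closed [simp]: "\<lbrakk>x \<in> X; y \<in> X\<rbrakk> \<Longrightarrow> Z_norm x y \<in> X"
  by (simp add: Z_norm_def)

lemma Z_norm_commute: "\<lbrakk>x \<in> X; y \<in> X\<rbrakk> \<Longrightarrow> Z_norm x y = Z_norm y x"
  by (simp add: Z_norm_def meet_commute join_commute)

lemma Z_norm_zero: "x \<in> X \<Longrightarrow> Z_norm \<zero> x = \<zero>"
  by (simp add: Z_norm_def)

text \<open>One half of associativity; the other half is this one read from right to left with
  commutativity, that is, applied to \<open>z\<close>, \<open>y\<close>, \<open>x\<close>.\<close>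

lemma Z_norm_assoc_if_nontrivial:
  assumes X: "x \<in> X" "y \<in> X" "z \<in> X"
    and yz: "y \<squnion> z = \<one>" and x_yz: "x \<squnion> (y \<sqinter> z) = \<one>"
    and mid: "\<exists>a\<in>{x, y, z}. middle_transitive a"
  shows "Z_norm x (Z_norm y z) = Z_norm (Z_norm x y) z"
proof -
  have "x \<squnion> y = \<one>" "x \<squnion> z = \<one>"
    using join_eq_one_if_middle_transitive[OF assms] by simp_all
  moreover have "(x \<sqinter> y) \<squnion> z = \<one>"
    using join_meet_eq_one_rotate[OF X yz x_yz] .
  ultimately show ?thesis
    using meet_assoc_if_joins_one X yz x_yz by (simp add: Z_norm_def)
qed

lemma Z_norm_eq_zero:
  assumes "x \<in> X" "y \<in> X" "z \<in> X" "\<not> (y \<squnion> z = \<one> \<and> x \<squnion> (y \<sqinter> z) = \<one>)"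
  shows "Z_norm x (Z_norm y z) = \<zero>"
proof (cases "y \<squnion> z = \<one>")
  case True
  with assms show ?thesis by (simp add: Z_norm_def)
next
  case False
  then have "Z_norm y z = \<zero>" by (simp add: Z_norm_def)
  then show ?thesis
    using assms by (metis Z_norm_commute Z_norm_zero zero_closed)
qed

lemma Z_norm_assoc_if_middle_transitive:
  assumes X: "x \<in> X" "y \<in> X" "z \<in> X"
    and mid: "\<exists>a\<in>{x, y, z}. middle_transitive a"
  shows "Z_norm x (Z_norm y z) = Z_norm (Z_norm x y) z"
proof -
  have flip: "Z_norm (Z_norm x y) z = Z_norm z (Z_norm y x)"
    "Z_norm x (Z_norm y z) = Z_norm (Z_norm z y) x"
    using X by (simp_all add: Z_norm_commute)
  have mid': "\<exists>a\<in>{z, y, x}. middle_transitive a"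
    using mid by blast
  consider "y \<squnion> z = \<one> \<and> x \<squnion> (y \<sqinter> z) = \<one>" | "y \<squnion> x = \<one> \<and> z \<squnion> (y \<sqinter> x) = \<one>"
    | "\<not> (y \<squnion> z = \<one> \<and> x \<squnion> (y \<sqinter> z) = \<one>)" "\<not> (y \<squnion> x = \<one> \<and> z \<squnion> (y \<sqinter> x) = \<one>)"
    by blast
  then show ?thesis
  proof cases
    case 1
    then show ?thesis using Z_norm_assoc_if_nontrivial X mid by blast
  next
    case 2
    then show ?thesis using Z_norm_assoc_if_nontrivial[of z y x] X mid' flip by simp
  next
    case 3
    then show ?thesis using Z_norm_eq_zero[of x y z] Z_norm_eq_zero[of z y x] X flip by simp
  qed
qed

lemma weakly_associative_Z_norm: "weakly_associative Z_norm"
  unfolding weakly_associative_def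
proof (intro ballI impI)
  fix x y z
  assume X: "x \<in> X" "y \<in> X" "z \<in> X"
    and "(\<exists>a\<in>{x, y, z}. meet_assoc_elem a) \<or> (\<exists>a\<in>{x, y, z}. join_assoc_elem a)"
  then have "\<exists>a\<in>{x, y, z}. middle_transitive a"
    using middle_transitive_if_meet_assoc middle_transitive_if_join_assoc by blast
  then show "Z_norm x (Z_norm y z) = Z_norm (Z_norm x y) z"
    using Z_norm_assoc_if_middle_transitive X by blast
qed

lemma weakly_increasing_Z_norm: "weakly_increasing Z_norm"
  unfolding weakly_increasing_def
proof (intro ballI impI, elim conjE)
  fix x y z
  assume X: "x \<in> X" "y \<in> X" "z \<in> X" and xy: "x \<unlhd> y"
    and tr: "transitive_elem x \<or> transitive_elem y"
  show "Z_norm x z \<unlhd> Z_norm y z"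
  proof (cases "x \<squnion> z = \<one>")
    case False
    then show ?thesis using X by (simp add: Z_norm_def[of x] zero_least)
  next
    case True
    have "x \<unlhd> y \<squnion> z"
      using tr X xy le_join1[of y z] join_closed[of y z]
      unfolding transitive_elem_def right_transitive_def middle_transitive_def by blast
    then have "x \<squnion> z \<unlhd> y \<squnion> z"
      using X by (simp add: join_leI)
    then have "y \<squnion> z = \<one>"
      using True X by (simp add: eq_one_if_one_le)
    moreover have "x \<sqinter> z \<unlhd> y"
      using tr X xy meet_le1[of x z] meet_closed[of x z]
      unfolding transitive_elem_def left_transitive_def middle_transitive_def by blast
    then have "x \<sqinter> z \<unlhd> y \<sqinter> z"
      using X by (simp add: le_meetI)
    ultimately show ?thesis
      using True by (simp add: Z_norm_def)
  qed
qed

lemma pseudo_t_norm_Z_norm: "pseudo_t_norm Z_norm"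
  unfolding pseudo_t_norm_def
  using weakly_increasing_Z_norm weakly_associative_Z_norm Z_norm_commute
  by (auto simp: Z_norm_def[of \<one>])

section \<open>Duality\<close>

lemma bounded_modular_trellis_dual:
  "bounded_modular_trellis X (\<lambda>x y. y \<unlhd> x) (\<squnion>) (\<sqinter>) \<one> \<zero>"
proof unfold_locales
  show "reflp_on X (\<lambda>x y. y \<unlhd> x)"
    using pseudo_refl by (simp add: reflp_on_def)
  show "antisymp_on X (\<lambda>x y. y \<unlhd> x)"
    using pseudo_antisym by (auto simp: antisymp_on_def)
next
  fix x y assume "x \<in> X" "y \<in> X"
  then show "is_infimum X (\<lambda>x y. y \<unlhd> x) x y (x \<squnion> y)"
    and "is_supremum X (\<lambda>x y. y \<unlhd> x) x y (x \<sqinter> y)"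
    using join_supremum meet_infimum by (auto simp: is_infimum_def is_supremum_def)
next
  fix x y z assume "x \<in> X" "y \<in> X" "z \<in> X" "z \<unlhd> x"
  then show "x \<sqinter> (y \<squnion> z) = (x \<sqinter> y) \<squnion> z"
    using modular[of z y x] by (simp add: join_commute meet_commute)
qed (simp_all add: zero_least one_greatest)

text \<open>Reversing the order interchanges left- and right-transitivity and the two arguments in the
  definition of \<open>weakly_increasing\<close>, and it interchanges the two kinds of associative elements, so both
  axioms are self-dual.\<close>

lemma pseudo_t_conorm_Z_conorm: "pseudo_t_conorm Z_conorm"
proof -
  interpret dual: bounded_modular_trellis X "\<lambda>x y. y \<unlhd> x" "(\<squnion>)" "(\<sqinter>)" \<one> \<zero>
    by (rule bounded_modular_trellis_dual)
  have Z: "dual.Z_norm = Z_conorm"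
    by (intro ext) (simp add: dual.Z_norm_def Z_conorm_def)
  have "dual.transitive_elem a \<longleftrightarrow> transitive_elem a" for a
    unfolding dual.transitive_elem_def transitive_elem_def dual.right_transitive_def
      right_transitive_def dual.left_transitive_def left_transitive_def
      dual.middle_transitive_def middle_transitive_def by blast
  then have incr: "weakly_increasing Z_conorm"
    using dual.weakly_increasing_Z_norm
    unfolding Z dual.weakly_increasing_def weakly_increasing_def by blast
  have "dual.meet_assoc_elem = join_assoc_elem" "dual.join_assoc_elem = meet_assoc_elem"
    by (auto simp: fun_eq_iff dual.meet_assoc_elem_def dual.join_assoc_elem_def
        meet_assoc_elem_def join_assoc_elem_def dual.meet_assoc_triple_def
        dual.join_assoc_triple_def meet_assoc_triple_def join_assoc_triple_def)
  then have "weakly_associative Z_conorm"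
    using dual.weakly_associative_Z_norm
    unfolding Z dual.weakly_associative_def weakly_associative_def by (simp add: disj_commute)
  with incr show ?thesis
    using dual.pseudo_t_norm_Z_norm
    unfolding Z dual.pseudo_t_norm_def pseudo_t_conorm_def by blast
qed

end

theorem proposition4p2:
  fixes X :: "'a set"
    and le :: "'a \<Rightarrow> 'a \<Rightarrow> bool"
    and meet join :: "'a \<Rightarrow> 'a \<Rightarrow> 'a"
    and zero one :: 'a
  assumes "bounded_modular_trellis X le meet join zero one"
  shows "bounded_trellis.pseudo_t_norm X le meet join one
           (bounded_trellis.Z_norm meet join zero one)
       \<and> bounded_trellis.pseudo_t_conorm X le meet join zero
           (bounded_trellis.Z_conorm meet join zero one)"
proof -
  interpret bounded_modular_trellis X le meet join zero one
    by (rule assms)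
  show ?thesis
    using pseudo_t_norm_Z_norm pseudo_t_conorm_Z_conorm by simp
qed

end
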